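(* The bivariate polynomial \[ W_3(s,t)=\sum_{\pi\in S_3} s^{\mathrm{pk}(\pi)+1}\,t^{\mathrm{pk}(\pi^{-1})+1} \] is not stable.
   Context: Let $S_n$ be the symmetric group of permutations of $\{1,\dots,n\}$. A permutation $\pi\in S_n$ has a peak at position $i$, where $2\le i\le n-1$, if $\pi(i-1)<\pi(i)>\pi(i+1)$. Let $\mathrm{pk}(\pi)$ denote the number of peaks of $\pi$. A polynomial $f(s,t)$ with nonnegative coefficients is called stable if $f(s,t)\neq 0$ for all complex numbers $s,t$ with $\mathrm{Im}(s)>0$ and $\mathrm{Im}(t)>0$. *)

theory Defs
  imports
    Complex_Main
    "HOL-Computational_Algebra.Polynomial"
    "HOL-Combinatorics.Permutations"
begin

definition pk :: "nat \<Rightarrow> (nat \<Rightarrow> nat) \<Rightarrow> nat" where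
  "pk n \<pi> = card {i \<in> {2..n - 1}. \<pi> (i - 1) < \<pi> i \<and> \<pi> i > \<pi> (i + 1)}"

text \<open>A polynomial in two variables s, t is encoded as an element of R[s][t]: the inner
  variable is s and the outer variable is t, so the coefficient of s^i t^j in f is
  coeff (coeff f j) i.\<close>

definition eval2 :: "real poly poly \<Rightarrow> complex \<Rightarrow> complex \<Rightarrow> complex" where
  "eval2 f s t = poly (map_poly (\<lambda>p. poly (map_poly of_real p) s) f) t"

definition nonneg_coeffs :: "real poly poly \<Rightarrow> bool" where
  "nonneg_coeffs f \<longleftrightarrow> (\<forall>i j. coeff (coeff f j) i \<ge> 0)"

text \<open>Stability is a notion for polynomials with nonnegative coefficients. That requirement is
  the domain of the notion and not a conjunct of the definition, so that failure of
  \<open>stable_poly\<close> always means the existence of a zero with both arguments in the open upper half-plane.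
  \<open>nonneg_coeffs_W\<close> shows that the polynomials W n below lie in this domain.\<close>

definition stable_poly :: "real poly poly \<Rightarrow> bool" where
  "stable_poly f \<longleftrightarrow> (\<forall>s t. Im s > 0 \<longrightarrow> Im t > 0 \<longrightarrow> eval2 f s t \<noteq> 0)"

definition W :: "nat \<Rightarrow> real poly poly" where
  "W n = (\<Sum>\<pi> | \<pi> permutes {1..n}. monom (monom 1 (pk n \<pi> + 1)) (pk n (inv \<pi>) + 1))"

lemma nonneg_coeffs_W: "nonneg_coeffs (W n)"
  unfolding nonneg_coeffs_def W_def
  by (auto simp: coeff_sum intro!: sum_nonneg)

lemma eval2_0: "eval2 0 s t = 0"
  by (simp add: eval2_def)

lemma eval2_add: "eval2 (f + g) s t = eval2 f s t + eval2 g s t"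
proof -
  have inner: "map_poly of_real (p + q) = (map_poly of_real p + map_poly of_real q :: complex poly)"
    for p q :: "real poly"
    by (intro poly_eqI) (simp add: coeff_map_poly)
  have "map_poly (\<lambda>p. poly (map_poly of_real p) s) (f + g) =
      map_poly (\<lambda>p. poly (map_poly of_real p) s) f + map_poly (\<lambda>p. poly (map_poly of_real p) s) g"
    by (intro poly_eqI) (simp add: coeff_map_poly inner)
  then show ?thesis
    by (simp add: eval2_def)
qed

lemma eval2_sum: "eval2 (\<Sum>x\<in>A. f x) s t = (\<Sum>x\<in>A. eval2 (f x) s t)"
  by (induction A rule: infinite_finite_induct) (simp_all add: eval2_0 eval2_add)

lemma eval2_monom: "eval2 (monom (monom c i) j) s t = of_real c * s ^ i * t ^ j"
  by (simp add: eval2_def map_poly_monom poly_monom)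

lemma eval2_W: "eval2 (W n) s t =
    (\<Sum>\<pi> | \<pi> permutes {1..n}. s ^ (pk n \<pi> + 1) * t ^ (pk n (inv \<pi>) + 1))"
  by (simp add: W_def eval2_sum eval2_monom)

end

theory Submission
  imports Defs
begin

text \<open>The only possible peak of a permutation in \<open>S\<^sub>3\<close> is at position 2, and it occurs exactly when
  the maximum 3 stands there. So 132 has a peak together with its inverse, 231 has a peak while its
  inverse does not, 312 is the other way round, and the remaining three permutations have no peak
  on either side. Consequently
  \<open>W\<^sub>3(s,t) = 3 s t + s\<^sup>2 t + s t\<^sup>2 + s\<^sup>2 t\<^sup>2 = s t ((s + 1) (t + 1) + 2)\<close>,
  and the last factor vanishes whenever \<open>s + 1\<close> and \<open>t + 1\<close> are points of the positive imaginary
  axis whose moduli have product 2.\<close>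

lemma pk_3:
  assumes "p permutes {1..3}"
  shows "pk 3 p = of_bool (p 2 = 3)"
proof -
  have "p 1 \<in> {1..3}" "p 2 \<in> {1..3}" "p 3 \<in> {1..3}"
    unfolding permutes_in_image[OF assms] by simp_all
  moreover have "p 1 \<noteq> p 2" "p 2 \<noteq> p 3" "p 1 \<noteq> p 3"
    using permutes_inj[OF assms] by (simp_all add: inj_eq)
  ultimately have "p 1 < p 2 \<and> p 2 > p 3 \<longleftrightarrow> p 2 = 3"
    unfolding atLeastAtMost_iff by linarith
  moreover have "{i \<in> {2..3 - 1}. p (i - 1) < p i \<and> p i > p (i + 1)} =
      (if p 1 < p 2 \<and> p 2 > p 3 then {2} else {})"
    by (auto simp: le_antisym)
  ultimately have "{i \<in> {2..3 - 1}. p (i - 1) < p i \<and> p i > p (i + 1)} = (if p 2 = 3 then {2} else {})"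
    by simp
  then show ?thesis
    by (simp add: pk_def)
qed

text \<open>Peaks of the inverse are read off from the permutation itself, which avoids computing any
  inverses when the six terms of \<open>W 3\<close> are evaluated.\<close>

lemma pk_3_inv:
  assumes "p permutes {1..3}"
  shows "pk 3 (inv p) = of_bool (p 3 = 2)"
  using pk_3[OF permutes_inv[OF assms]] permutes_inv_eq[OF assms, of 2 3] by simp

lemma sum_permutations_3:
  fixes f :: "(nat \<Rightarrow> nat) \<Rightarrow> 'a::comm_monoid_add"
  shows "(\<Sum>p | p permutes {1..3}. f p) =
    (\<Sum>b\<in>{1, 2, 3}. \<Sum>c\<in>{2, 3}. f (transpose 1 b \<circ> transpose 2 c))"
proof -
  have "{1..3::nat} = {1, 2, 3}"
    by auto
  moreover have "{p. p permutes {3::nat}} = {id}"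
    by auto
  ultimately show ?thesis
    by (simp add: sum_over_permutations_insert)
qed

lemma eval2_W_3: "eval2 (W 3) s t = s * t * ((s + 1) * (t + 1) + 2)"
proof -
  have "eval2 (W 3) s t =
      (\<Sum>p | p permutes {1..3::nat}. s ^ (of_bool (p 2 = 3) + 1) * t ^ (of_bool (p 3 = 2) + 1))"
    unfolding eval2_W by (intro sum.cong refl) (simp add: pk_3 pk_3_inv)
  also have "\<dots> = s * t * ((s + 1) * (t + 1) + 2)"
    unfolding sum_permutations_3 by (simp add: transpose_def algebra_simps)
  finally show ?thesis .
qed

theorem proposition2p1:
  shows "\<not> stable_poly (W 3)"
proof -
  define s t where "s = Complex (-1) 1" and "t = Complex (-1) 2"
  have "(s + 1) * (t + 1) + 2 = 0"
    by (simp add: s_def t_def complex_eq_iff)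
  then have "eval2 (W 3) s t = 0"
    by (simp add: eval2_W_3)
  moreover have "Im s > 0" "Im t > 0"
    by (simp_all add: s_def t_def)
  ultimately show ?thesis
    unfolding stable_poly_def by blast
qed

end
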